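(* For the Barab\'asi-Albert (BA) model with the special attachment scheme described in the context, if vertex $i$ has degree $k_i(t)$ at time $t$, then the probability that vertex $i$ receives a new edge from the new vertex at time $t+1$ is exactly equal to $m\,\Pi(k_i)$, where $$\Pi(k_i)=\frac{k_i(t)}{\sum_j k_j(t)},$$ the sum being over all vertices $j$ present at time $t$.
   Context: BA model. The network starts with a small number $m_0$ of vertices. At every time step a new vertex is added with $m$ ($\le m_0$) edges that link the new vertex to $m$ different vertices already present in the network. Let $k_j(t)$ be the degree of vertex $j$ at time $t$. Special attachment scheme (the Holme-Kim scheme with parameter $p=1$). When a new vertex comes into the network at time $t+1$: (1) the first edge connects to an existing vertex $l$ with the preferential attachment probability $\Pi(k_l)=k_l(t)/\sum_j k_j(t)$; (2) the remaining $m-1$ edges simultaneously connect to $m-1$ vertices randomly chosen from inside the neighborhood $O_l(t)$ of the vertex $l$ to which the first edge was connected, i.e. a uniformly random $(m-1)$-element subset of the $k_l(t)$ vertices adjacent to $l$ at time $t$. Multiple edges are not allowed. *)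

theory Defs
  imports "HOL-Probability.Probability" "Graph_Theory.Pair_Digraph"
begin

text \<open>
  A network is a finite simple graph, in the encoding of \<^locale>\<open>pair_graph\<close>: an undirected edge
  between u and v is the pair of arcs (u, v) and (v, u).  There are no loops and no multiple
  edges, and the degree of a vertex is its out-degree, which is the number of its neighbours.
\<close>

type_synonym network = "nat pair_pre_digraph"

abbreviation vertex_degree :: "network \<Rightarrow> nat \<Rightarrow> nat" where
  "vertex_degree G v \<equiv> out_degree (with_proj G) v"

definition neighborhood :: "network \<Rightarrow> nat \<Rightarrow> nat set" where
  "neighborhood G v = {u. v \<rightarrow>\<^bsub>with_proj G\<^esub> u}"

definition pref_prob :: "network \<Rightarrow> nat \<Rightarrow> real" where
  "pref_prob G v = real (vertex_degree G v) / (\<Sum>j\<in>pverts G. real (vertex_degree G j))"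

text \<open>
  The lemma after the definition shows that \<^const>\<open>embed_pmf\<close> is applied to a genuine
  probability mass function as soon as the network has an edge.
\<close>

definition first_target :: "network \<Rightarrow> nat pmf" where
  "first_target G = embed_pmf (pref_prob G)"

lemma pmf_first_target:
  assumes "pair_graph G" and "parcs G \<noteq> {}"
  shows "pmf (first_target G) v = pref_prob G v"
proof -
  interpret pair_graph G by fact
  let ?s = "\<Sum>j\<in>pverts G. real (vertex_degree G j)"
  have fin: "finite (pverts G)" by (rule pair_finite_verts)
  have out0: "vertex_degree G v = 0" if "v \<notin> pverts G" for v
  proof -
    have "out_arcs (with_proj G) v = {}"
      using that by (auto simp: out_arcs_def dest: in_arcsD1)
    then show ?thesis by (simp add: out_degree_def)
  qed
  obtain a where a: "a \<in> parcs G" using assms(2) by blast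
  have "finite (out_arcs (with_proj G) (fst a))"
    by (rule finite_subset[OF _ pair_finite_arcs]) (auto simp: out_arcs_def)
  moreover have "a \<in> out_arcs (with_proj G) (fst a)" using a by (simp add: out_arcs_def)
  ultimately have "vertex_degree G (fst a) > 0" by (auto simp: out_degree_def card_gt_0_iff)
  with a have pos: "?s > 0"
    by (intro sum_pos2[OF fin, of "fst a"]) (auto intro: arc_fst_in_verts)
  have nonneg: "pref_prob G v \<ge> 0" for v by (simp add: pref_prob_def sum_nonneg)
  have "(\<integral>\<^sup>+ v. ennreal (pref_prob G v) \<partial>count_space UNIV) = (\<Sum>v\<in>pverts G. ennreal (pref_prob G v))"
    by (rule nn_integral_count_space'[OF fin]) (auto simp: pref_prob_def out0)
  also have "\<dots> = ennreal (\<Sum>v\<in>pverts G. pref_prob G v)"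
    using nonneg by (simp add: sum_ennreal)
  also have "(\<Sum>v\<in>pverts G. pref_prob G v) = 1"
    unfolding pref_prob_def using pos by (simp flip: sum_divide_distrib)
  finally show ?thesis
    unfolding first_target_def by (intro pmf_embed_pmf) (simp_all add: nonneg)
qed

text \<open>The random set of old vertices to which a new vertex is linked.\<close>

definition target_set :: "nat \<Rightarrow> network \<Rightarrow> nat set pmf" where
  "target_set m G =
     bind_pmf (first_target G) (\<lambda>l.
     map_pmf (insert l) (pmf_of_set {S. S \<subseteq> neighborhood G l \<and> card S = m - 1}))"

text \<open>
  Vertices are numbered in order of arrival: the initial ones are 0, ..., m0 - 1, and the
  next vertex to come into a network is always numbered by the current number of vertices.
\<close>

definition new_vertex :: "network \<Rightarrow> nat" where
  "new_vertex G = card (pverts G)"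

definition add_vertex :: "nat set \<Rightarrow> network \<Rightarrow> network" where
  "add_vertex S G =
     \<lparr> pverts = insert (new_vertex G) (pverts G),
       parcs = parcs G \<union> {new_vertex G} \<times> S \<union> S \<times> {new_vertex G} \<rparr>"

definition growth_step :: "nat \<Rightarrow> network \<Rightarrow> network pmf" where
  "growth_step m G = map_pmf (\<lambda>S. add_vertex S G) (target_set m G)"

primrec network_at :: "nat \<Rightarrow> network \<Rightarrow> nat \<Rightarrow> network pmf" where
  "network_at m G0 0 = return_pmf G0"
| "network_at m G0 (Suc t) = bind_pmf (network_at m G0 t) (growth_step m)"

text \<open>The joint distribution of the networks at times t and t + 1.\<close>

definition network_pair_at :: "nat \<Rightarrow> network \<Rightarrow> nat \<Rightarrow> (network \<times> network) pmf" where
  "network_pair_at m G0 t =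
     bind_pmf (network_at m G0 t) (\<lambda>G. map_pmf (Pair G) (growth_step m G))"

text \<open>
  The last two conditions say exactly that the first growth step can be carried out: some vertex
  has positive degree, and every vertex that can be chosen by the first edge has m - 1 neighbours
  for the other edges.  They are inherited by all later networks.
\<close>

definition initial_network :: "nat \<Rightarrow> nat \<Rightarrow> network \<Rightarrow> bool" where
  "initial_network m m0 G0 \<longleftrightarrow>
     pair_graph G0 \<and> pverts G0 = {..<m0} \<and> parcs G0 \<noteq> {} \<and>
     (\<forall>l\<in>pverts G0. vertex_degree G0 l > 0 \<longrightarrow> m - 1 \<le> vertex_degree G0 l)"

end

(*
  Vertex i is chosen by the first edge with probability k_i / K, where K is the sum of all degrees.
  It is chosen by one of the other edges only via a neighbour l of i.  Each such l contributes
  k_l / K * (m - 1) / k_l = (m - 1) / K, independently of k_l, so the k_i neighbours contribute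
  (m - 1) k_i / K together.
*)

theory Submission
  imports Defs
begin

section \<open>Probability mass functions\<close>

text \<open>Law of total probability. Encoding the event as the value \<open>True\<close> of a
  Boolean variable reduces it to the pointwise formula \<open>pmf_bind\<close>.\<close>

lemma measure_bind_pmf:
  "measure_pmf.prob (bind_pmf p f) A = (\<integral>x. measure_pmf.prob (f x) A \<partial>measure_pmf p)"
proof -
  have eq: "measure_pmf.prob q A = pmf (map_pmf (\<lambda>y. y \<in> A) q) True" for q :: "'a pmf"
    by (simp add: pmf_map vimage_def)
  show ?thesis
    unfolding eq by (simp add: map_bind_pmf pmf_bind)
qed

text \<open>The pair records the first draw, so only \<open>x = a\<close> contributes to the
  integral.\<close>

lemma pmf_bind_map_Pair:
  "pmf (bind_pmf p (\<lambda>x. map_pmf (Pair x) (q x))) (a, b) = pmf p a * pmf (q a) b"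
proof -
  have "pmf (map_pmf (Pair x) (q x)) (a, b) = (if x = a then pmf (q a) b else 0)" for x
    by (auto simp: pmf_map_inj' inj_on_def pmf_eq_0_set_pmf)
  then have "pmf (bind_pmf p (\<lambda>x. map_pmf (Pair x) (q x))) (a, b)
      = (\<integral>x. (if x = a then pmf (q a) b else 0) \<partial>measure_pmf p)"
    by (simp add: pmf_bind)
  also have "\<dots> = (\<Sum>x\<in>{a}. (if x = a then pmf (q a) b else 0) * pmf p x)"
    by (rule integral_measure_pmf_real) (auto split: if_splits)
  finally show ?thesis by simp
qed

text \<open>The joint weight of \<open>(a, y)\<close> and the probability of the conditioning event
  share the factor \<open>pmf p a\<close>, which cancels. This turns conditioning on the network at
  time t into a single growth step from it.\<close>

lemma cond_pmf_bind_map_Pair: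
  assumes "a \<in> set_pmf p"
  shows "cond_pmf (bind_pmf p (\<lambda>x. map_pmf (Pair x) (q x))) {(x, y). x = a} = map_pmf (Pair a) (q a)"
    (is "cond_pmf ?b ?A = _")
proof (rule pmf_eqI)
  fix z :: "'a \<times> 'b"
  obtain x y where z: "z = (x, y)" by fastforce
  have ne: "set_pmf ?b \<inter> ?A \<noteq> {}"
    using assms set_pmf_not_empty[of "q a"] by fastforce
  \<comment> \<open>The first marginal of the joint law is \<open>p\<close>; this gives the
    probability of the conditioning event.\<close>
  have "map_pmf fst ?b = p"
    by (simp add: map_bind_pmf map_pmf_comp bind_return_pmf')
  then have "pmf p a = measure_pmf.prob ?b (fst -` {a})"
    by (metis pmf_map)
  also have "fst -` {a} = ?A" by auto
  finally have "measure_pmf.prob ?b ?A = pmf p a" by simp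
  moreover have "pmf p a \<noteq> 0" using assms by (simp add: set_pmf_iff)
  moreover have "pmf (map_pmf (Pair a) (q a)) (x, y) = (if x = a then pmf (q a) y else 0)"
    by (auto simp: pmf_map_inj' inj_on_def pmf_eq_0_set_pmf)
  ultimately show "pmf (cond_pmf ?b ?A) z = pmf (map_pmf (Pair a) (q a)) z"
    by (simp add: pmf_cond[OF ne] pmf_bind_map_Pair z)
qed

section \<open>Uniformly random subsets of fixed size\<close>

lemma k_subsets_nonempty:
  assumes "finite A" and "k \<le> card A"
  shows "{S. S \<subseteq> A \<and> card S = k} \<noteq> {}"
  using obtain_subset_with_card_n[OF assms(2)] by blast

text \<open>Deleting \<open>x\<close> is a bijection onto the \<open>(k - 1)\<close>-subsets of
  \<open>A - {x}\<close>. For \<open>k = 0\<close> truncated subtraction would make the right side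
  1, while no set qualifies.\<close>

lemma card_k_subsets_containing:
  assumes "finite A" and "x \<in> A" and "0 < k"
  shows "card {S. S \<subseteq> A \<and> card S = k \<and> x \<in> S} = (card A - 1) choose (k - 1)"
proof -
  have "{S. S \<subseteq> A \<and> card S = k \<and> x \<in> S} = insert x ` {S. S \<subseteq> A - {x} \<and> card S = k - 1}"
    (is "?L = ?R")
  proof (intro equalityI subsetI)
    fix S assume S: "S \<in> ?L"
    then have "S = insert x (S - {x})" "card (S - {x}) = k - 1"
      using assms finite_subset[of S A] by auto
    with S show "S \<in> ?R" by blast
  next
    fix S assume "S \<in> ?R"
    then obtain T where T: "S = insert x T" "T \<subseteq> A - {x}" "card T = k - 1" by blast
    then have "finite T" using assms(1) finite_subset by blast
    moreover have "x \<notin> T" using T(2) by blast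
    ultimately show "S \<in> ?L" using T assms by auto
  qed
  moreover have "inj_on (insert x) {S. S \<subseteq> A - {x} \<and> card S = k - 1}"
    by (auto simp: inj_on_def)
  ultimately show ?thesis
    using assms n_subsets[of "A - {x}" "k - 1"] by (simp add: card_image)
qed

lemma prob_in_random_k_subset:
  assumes "finite A" and "x \<in> A" and "k \<le> card A"
  shows "measure_pmf.prob (pmf_of_set {S. S \<subseteq> A \<and> card S = k}) {S. x \<in> S} = real k / real (card A)"
proof -
  let ?F = "{S. S \<subseteq> A \<and> card S = k}"
  have fin: "finite ?F" using assms(1) by simp
  have pos: "0 < card A" using assms by (auto simp: card_gt_0_iff)
  have "measure_pmf.prob (pmf_of_set ?F) {S. x \<in> S}
      = real (card (?F \<inter> {S. x \<in> S})) / real (card A choose k)"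
    using fin k_subsets_nonempty[OF assms(1,3)] assms(1) by (simp add: measure_pmf_of_set n_subsets)
  also have "?F \<inter> {S. x \<in> S} = {S. S \<subseteq> A \<and> card S = k \<and> x \<in> S}" by auto
  also have "real (card \<dots>) / real (card A choose k) = real k / real (card A)"
  \<comment> \<open>\<open>k = 0\<close> arises for \<open>m = 1\<close>, where the first edge is
    the only one; the counting lemma excludes it.\<close>
  proof (cases "k = 0")
    case True
    have none: "{S. S \<subseteq> A \<and> card S = 0 \<and> x \<in> S} = {}"
      using assms(1) by (auto dest: finite_subset)
    show ?thesis unfolding True none by simp
  next
    case False
    \<comment> \<open>Absorption identity for binomial coefficients; the claim is its quotient
      form.\<close>
    have "real k * real (card A choose k) = real (card A) * real ((card A - 1) choose (k - 1))"
      using times_binomial_minus1_eq[of k "card A"] False by (metis neq0_conv of_nat_mult)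
    moreover have "real (card A choose k) > 0" using assms(3) by simp
    ultimately show ?thesis
      using False pos by (simp add: card_k_subsets_containing[OF assms(1,2)] frac_eq_eq mult.commute)
  qed
  finally show ?thesis .
qed

section \<open>Networks\<close>

lemma mem_neighborhood [simp]: "u \<in> neighborhood G v \<longleftrightarrow> (v, u) \<in> parcs G"
  by (simp add: neighborhood_def)

lemma vertex_degree_eq_card_neighborhood: "vertex_degree G v = card (neighborhood G v)"
proof -
  have "out_arcs (with_proj G) v = Pair v ` neighborhood G v"
    by (auto simp: out_arcs_def)
  then show ?thesis by (simp add: out_degree_def card_image inj_on_def)
qed

lemma finite_neighborhood:
  assumes "pair_graph G"
  shows "finite (neighborhood G v)"
proof -
  interpret pair_graph G by fact
  have "neighborhood G v \<subseteq> pverts G" by (auto dest: in_arcsD2)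
  then show ?thesis using pair_finite_verts by (rule finite_subset)
qed

lemma vertex_degree_pos_iff:
  assumes "pair_graph G"
  shows "0 < vertex_degree G v \<longleftrightarrow> (\<exists>u. (v, u) \<in> parcs G)"
  using finite_neighborhood[OF assms, of v]
  by (simp add: vertex_degree_eq_card_neighborhood card_gt_0_iff set_eq_iff)

section \<open>Supports of the random choices\<close>

lemma set_pmf_first_target:
  assumes "pair_graph G" and "parcs G \<noteq> {}" and "l \<in> set_pmf (first_target G)"
  shows "l \<in> pverts G" and "0 < vertex_degree G l"
proof -
  interpret pair_graph G by fact
  have "pref_prob G l \<noteq> 0"
    using assms by (metis pmf_first_target set_pmf_iff)
  then show "0 < vertex_degree G l"
    by (auto simp: pref_prob_def)
  then show "l \<in> pverts G"
    using vertex_degree_pos_iff[OF assms(1)] by (auto dest: in_arcsD1)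
qed

text \<open>These are the properties of a target set under which growth preserves
  \<open>initial_network\<close>. The predicate is used for any network reached, with
  \<open>n\<close> its current number of vertices.\<close>

lemma set_pmf_target_set:
  assumes "initial_network m n G" and "1 \<le> m" and "S \<in> set_pmf (target_set m G)"
  shows "S \<subseteq> pverts G" and "card S = m" and "\<forall>v\<in>S. 0 < vertex_degree G v"
proof -
  have pg: "pair_graph G" and ne: "parcs G \<noteq> {}"
    and deg: "\<And>l. l \<in> pverts G \<Longrightarrow> 0 < vertex_degree G l \<Longrightarrow> m - 1 \<le> vertex_degree G l"
    using assms(1) by (auto simp: initial_network_def)
  interpret pair_graph G by fact
  from assms(3) obtain l where l: "l \<in> set_pmf (first_target G)"
    and S: "S \<in> insert l ` set_pmf (pmf_of_set {T. T \<subseteq> neighborhood G l \<and> card T = m - 1})"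
    by (auto simp: target_set_def)
  note l' = set_pmf_first_target[OF pg ne l]
  have fin: "finite (neighborhood G l)" using pg by (rule finite_neighborhood)
  \<comment> \<open>The degree condition makes this family nonempty, so \<open>pmf_of_set\<close> is
    a genuine uniform distribution.\<close>
  then have "{T. T \<subseteq> neighborhood G l \<and> card T = m - 1} \<noteq> {}"
    using deg[OF l'] by (intro k_subsets_nonempty) (simp_all add: vertex_degree_eq_card_neighborhood)
  with S fin obtain T where T: "S = insert l T" "T \<subseteq> neighborhood G l" "card T = m - 1"
    by auto
  have TN: "(l, v) \<in> parcs G" if "v \<in> T" for v using that T(2) by auto
  have "finite T" using T(2) fin by (rule finite_subset)
  \<comment> \<open>Without loops \<open>l\<close> is not its own neighbour, so inserting it adds
    exactly one to \<open>m - 1\<close>.\<close>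
  moreover have "l \<notin> T" using TN no_loops' by blast
  ultimately show "card S = m" using T assms(2) by simp
  show "S \<subseteq> pverts G" using l'(1) T(1) TN in_arcsD2 by blast
  show "\<forall>v\<in>S. 0 < vertex_degree G v"
  proof
    fix v assume "v \<in> S"
    then consider "v = l" | "(v, l) \<in> parcs G" using T(1) TN arcs_symmetric by blast
    then show "0 < vertex_degree G v"
      using l'(2) vertex_degree_pos_iff[OF pg, of v] by cases auto
  qed
qed

section \<open>Growth preserves the network conditions\<close>

lemma new_vertex_notin:
  assumes "initial_network m n G"
  shows "new_vertex G \<notin> pverts G"
  using assms by (simp add: initial_network_def new_vertex_def)

text \<open>The new vertex is fresh, so no old arc starts there, and
  \<open>S \<subseteq> pverts G\<close> keeps it out of \<open>S\<close>, so no loop arises.\<close>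

lemma neighborhood_add_vertex_new:
  assumes "initial_network m n G" and "S \<subseteq> pverts G"
  shows "neighborhood (add_vertex S G) (new_vertex G) = S"
proof -
  interpret pair_graph G using assms(1) by (simp add: initial_network_def)
  show ?thesis
    using new_vertex_notin[OF assms(1)] assms(2) by (auto simp: add_vertex_def dest: in_arcsD1)
qed

text \<open>The new vertex has degree \<open>m\<close>, and old degrees never decrease.
  \<open>Sdeg\<close> prevents linking to an isolated vertex, whose new degree 1 would violate the
  bound when \<open>m > 2\<close>.\<close>

lemma initial_network_add_vertex:
  assumes G: "initial_network m n G" and S: "S \<subseteq> pverts G" "card S = m"
    and Sdeg: "\<forall>v\<in>S. 0 < vertex_degree G v"
  shows "initial_network m (Suc n) (add_vertex S G)"
proof -
  let ?H = "add_vertex S G"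
  have pg: "pair_graph G" and verts: "pverts G = {..<n}" and ne: "parcs G \<noteq> {}"
    and deg: "\<And>l. l \<in> pverts G \<Longrightarrow> 0 < vertex_degree G l \<Longrightarrow> m - 1 \<le> vertex_degree G l"
    using G by (auto simp: initial_network_def)
  interpret pair_graph G by fact
  have new: "new_vertex G = n" using verts by (simp add: new_vertex_def)
  have finS: "finite S" using S(1) pair_finite_verts by (rule finite_subset)
  have pgH: "pair_graph ?H"
  proof unfold_locales
    show "fst e \<in> pverts ?H" "snd e \<in> pverts ?H" if "e \<in> parcs ?H" for e
      using that S(1) arc_fst_in_verts arc_snd_in_verts by (auto simp: add_vertex_def)
    show "finite (pverts ?H)" "finite (parcs ?H)"
      using finS pair_finite_verts pair_finite_arcs by (auto simp: add_vertex_def)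
    show "fst e \<noteq> snd e" if "e \<in> parcs ?H" for e
      using that S(1) new_vertex_notin[OF G] no_loops' by (auto simp: add_vertex_def)
    show "symmetric (with_proj ?H)"
      using arcs_symmetric by (auto simp: symmetric_def sym_def add_vertex_def)
  qed
  have "m - 1 \<le> vertex_degree ?H l" if l: "l \<in> pverts ?H" and pos: "0 < vertex_degree ?H l" for l
  proof (cases "l = new_vertex G")
    case True
    then show ?thesis
      using neighborhood_add_vertex_new[OF G S(1)] S(2)
      by (simp add: vertex_degree_eq_card_neighborhood)
  next
    case False
    then have lG: "l \<in> pverts G" using l by (simp add: add_vertex_def)
    from pos obtain u where "(l, u) \<in> parcs ?H"
      using vertex_degree_pos_iff[OF pgH] by blast
    \<comment> \<open>Either the arc is old, or it leads to the new vertex; then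
      \<open>l \<in> S\<close> and \<open>Sdeg\<close> applies.\<close>
    then have "0 < vertex_degree G l"
      using False Sdeg vertex_degree_pos_iff[OF pg] by (auto simp: add_vertex_def)
    then have "m - 1 \<le> vertex_degree G l" using lG deg by blast
    also have "\<dots> \<le> vertex_degree ?H l"
      unfolding vertex_degree_eq_card_neighborhood
      by (rule card_mono[OF finite_neighborhood[OF pgH]]) (auto simp: add_vertex_def)
    finally show ?thesis .
  qed
  moreover have "pverts ?H = {..<Suc n}" "parcs ?H \<noteq> {}"
    using verts ne new by (simp_all add: add_vertex_def lessThan_Suc)
  ultimately show ?thesis using pgH by (simp add: initial_network_def)
qed

lemma initial_network_network_at:
  assumes "1 \<le> m" and "initial_network m m0 G0" and "G \<in> set_pmf (network_at m G0 t)"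
  shows "initial_network m (m0 + t) G"
  using assms(3)
proof (induction t arbitrary: G)
  case 0
  then show ?case using assms(2) by simp
next
  case (Suc t)
  then obtain H S where H: "H \<in> set_pmf (network_at m G0 t)"
    and S: "S \<in> set_pmf (target_set m H)" and G: "G = add_vertex S H"
    by (auto simp: growth_step_def)
  have "initial_network m (m0 + t) H" using H by (rule Suc.IH)
  from initial_network_add_vertex[OF this set_pmf_target_set[OF this assms(1) S]] G
  show ?case by simp
qed

section \<open>The probability of being chosen as a target\<close>

lemma prob_mem_target_set:
  assumes "initial_network m n G" and "1 \<le> m" and i: "i \<in> pverts G"
  shows "measure_pmf.prob (target_set m G) {S. i \<in> S} = real m * pref_prob G i"
proof -
  have pg: "pair_graph G" and ne: "parcs G \<noteq> {}"
    and deg: "\<And>l. l \<in> pverts G \<Longrightarrow> 0 < vertex_degree G l \<Longrightarrow> m - 1 \<le> vertex_degree G l"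
    using assms(1) by (auto simp: initial_network_def)
  interpret pair_graph G by fact
  let ?U = "\<lambda>l. pmf_of_set {T. T \<subseteq> neighborhood G l \<and> card T = m - 1}"
  let ?K = "\<Sum>j\<in>pverts G. real (vertex_degree G j)"
  let ?hit = "\<lambda>l. measure_pmf.prob (map_pmf (insert l) (?U l)) {S. i \<in> S}"
  \<comment> \<open>The two terms separate a hit by the first edge from a hit by one of the others.
    In the second, the factor \<open>vertex_degree G l\<close> has cancelled.\<close>
  have hit: "?hit l * pref_prob G l = (if l = i then pref_prob G i else 0)
      + (if l \<in> neighborhood G i then real (m - 1) / ?K else 0)"
    if l: "l \<in> pverts G" for l
  proof (cases "0 < vertex_degree G l")
    \<comment> \<open>Here the family behind \<open>?U l\<close> may be empty, but the weight
      \<open>pref_prob G l\<close> is 0, so the value of \<open>?hit l\<close> is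
      irrelevant.\<close>
    case False
    then have "l \<notin> neighborhood G i"
      using vertex_degree_pos_iff[OF pg] arcs_symmetric by auto
    with False show ?thesis by (auto simp: pref_prob_def)
  next
    case True
    have fin: "finite (neighborhood G l)" using pg by (rule finite_neighborhood)
    have k: "m - 1 \<le> card (neighborhood G l)"
      using deg[OF l True] by (simp add: vertex_degree_eq_card_neighborhood)
    consider "l = i" | "l \<noteq> i" "l \<in> neighborhood G i" | "l \<noteq> i" "l \<notin> neighborhood G i"
      by blast
    then show ?thesis
    proof cases
      \<comment> \<open>Inserting \<open>l = i\<close> makes the hit certain; absence of loops makes
        the second term vanish.\<close>
      case 1
      then have "l \<notin> neighborhood G i" using no_loops' by auto
      with 1 show ?thesis by (simp add: vimage_def)
    next
      case 2
      have "?hit l = measure_pmf.prob (?U l) {S. i \<in> S}"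
        using 2(1) by (simp add: vimage_def)
      also have "\<dots> = real (m - 1) / real (vertex_degree G l)"
        unfolding vertex_degree_eq_card_neighborhood using 2(2) arcs_symmetric
        by (intro prob_in_random_k_subset[OF fin _ k]) auto
      finally show ?thesis using 2 True by (simp add: pref_prob_def)
    next
      case 3
      then have "i \<notin> neighborhood G l" using arcs_symmetric by auto
      then have "set_pmf (?U l) \<inter> {S. i \<in> S} = {}"
        using fin k_subsets_nonempty[OF fin k] by auto
      then have "measure_pmf.prob (?U l) {S. i \<in> S} = 0"
        by (simp add: measure_pmf_zero_iff)
      with 3 show ?thesis by (simp add: vimage_def)
    qed
  qed
  have "measure_pmf.prob (target_set m G) {S. i \<in> S} = (\<integral>l. ?hit l \<partial>measure_pmf (first_target G))"
    unfolding target_set_def by (rule measure_bind_pmf)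
  also have "\<dots> = (\<Sum>l\<in>pverts G. ?hit l * pmf (first_target G) l)"
    using pair_finite_verts set_pmf_first_target(1)[OF pg ne] by (rule integral_measure_pmf_real)
  also have "\<dots> = (\<Sum>l\<in>pverts G. ?hit l * pref_prob G l)"
    by (simp add: pmf_first_target[OF pg ne])
  also have "\<dots> = (\<Sum>l\<in>pverts G. if l = i then pref_prob G i else 0)
      + (\<Sum>l\<in>pverts G. if l \<in> neighborhood G i then real (m - 1) / ?K else 0)"
    by (simp only: sum.distrib[symmetric] hit cong: sum.cong)
  also have "(\<Sum>l\<in>pverts G. if l = i then pref_prob G i else 0) = pref_prob G i"
    using i pair_finite_verts by simp
  also have "(\<Sum>l\<in>pverts G. if l \<in> neighborhood G i then real (m - 1) / ?K else 0)
      = real (card (pverts G \<inter> neighborhood G i)) * (real (m - 1) / ?K)"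
    using pair_finite_verts by (subst sum.inter_restrict[symmetric]) auto
  also have "pverts G \<inter> neighborhood G i = neighborhood G i"
    by (auto dest: in_arcsD2)
  also have "real (card (neighborhood G i)) * (real (m - 1) / ?K) = real (m - 1) * pref_prob G i"
    by (simp add: pref_prob_def vertex_degree_eq_card_neighborhood)
  \<comment> \<open>The coefficients 1 and \<open>real (m - 1)\<close> add up to
    \<open>real m\<close> because \<open>1 \<le> m\<close>.\<close>
  finally show ?thesis using assms(2) by (simp add: algebra_simps)
qed

text \<open>Conditioning the joint law of two consecutive networks on the earlier one being
  \<open>G\<close> expresses the probability given the state at time t; the support assumption gives
  the condition positive probability.\<close>

theorem mainTheorem2:
  fixes m m0 t i :: nat and G0 G :: network
  assumes "1 \<le> m" and "m \<le> m0"
    and "initial_network m m0 G0"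
    and "G \<in> set_pmf (network_at m G0 t)"
    and "i \<in> pverts G"
  shows "measure_pmf.prob (cond_pmf (network_pair_at m G0 t) {(H, H'). H = G})
           {(H, H'). i \<in> neighborhood H' (new_vertex H)} = real m * pref_prob G i"
proof -
  have G: "initial_network m (m0 + t) G"
    using assms(1,3,4) by (rule initial_network_network_at)
  have "measure_pmf.prob (cond_pmf (network_pair_at m G0 t) {(H, H'). H = G})
          {(H, H'). i \<in> neighborhood H' (new_vertex H)}
      = measure_pmf.prob (target_set m G) {S. i \<in> neighborhood (add_vertex S G) (new_vertex G)}"
    unfolding network_pair_at_def cond_pmf_bind_map_Pair[OF assms(4)] growth_step_def
    by (simp add: vimage_def del: mem_neighborhood)
  also have "\<dots> = measure_pmf.prob (target_set m G) {S. i \<in> S}"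
    \<comment> \<open>The two events need agree only almost surely: the neighbourhood of the new
      vertex equals \<open>S\<close> when \<open>S \<subseteq> pverts G\<close>, which holds on the
      support of \<open>target_set\<close>.\<close>
    using set_pmf_target_set(1)[OF G assms(1)] neighborhood_add_vertex_new[OF G]
    by (intro measure_pmf.finite_measure_eq_AE) (auto simp: AE_measure_pmf_iff simp del: mem_neighborhood)
  also have "\<dots> = real m * pref_prob G i"
    using G assms(1,5) by (rule prob_mem_target_set)
  finally show ?thesis .
qed

end
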